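(* Let $C$ be a reproducing normal cone in a Banach space $(X,\|\cdot\|)$, and let $h:X\to X$ be a map which is continuous, positively homogeneous, and order-preserving with respect to $C$. Then $h(C)\subset C$, $h(-C)\subset -C$ and $$\tilde r(h)=\max(\tilde r_C(h),\tilde r_{-C}(h))=\max(r_C(h),r_{-C}(h))=r(h).$$
   Context: A subset $C$ of the real Banach space $X$ is a cone if $tC\subset C$ for all $t\ge 0$; it is proper if it is closed, convex and pointed ($C\cap(-C)=\{0\}$). A proper cone induces the partial order $x\le y\iff y-x\in C$. $C$ is normal if it is proper and there is a constant $M$ with $\|x\|\le M\|y\|$ whenever $0\le x\le y$; it is reproducing if $X=C-C$. Positively homogeneous: $h(tx)=th(x)$ for all $t>0$. Order-preserving: $x\le y$ implies $h(x)\le h(y)$. For a cone $K$ (here $K=C$, $-C$ or $X$) and a homogeneous map $h$ with $h(K)\subset K$: $\|h\|_K=\sup_{x\in K\setminus\{0\}}\|h(x)\|/\|x\|$; Bonsall's cone spectral radius is $\tilde r_K(h)=\lim_{k\to\infty}\|h^k\|_K^{1/k}=\inf_{k\ge1}\|h^k\|_K^{1/k}$; the cone spectral radius is $r_K(h)=\sup_{x\in K}\limsup_{k\to\infty}\|h^k(x)\|^{1/k}$. The subscript is omitted when $K=X$: $\tilde r(h)=\tilde r_X(h)$, $r(h)=r_X(h)$. *)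

theory Defs
  imports "HOL-Analysis.Analysis"
begin

definition proper_cone :: "'a::real_normed_vector set \<Rightarrow> bool" where
  "proper_cone C \<longleftrightarrow> cone C \<and> closed C \<and> convex C \<and> C \<inter> uminus ` C = {0}"

definition cone_le :: "'a::real_normed_vector set \<Rightarrow> 'a \<Rightarrow> 'a \<Rightarrow> bool" where
  "cone_le C x y \<longleftrightarrow> y - x \<in> C"

definition normal_cone :: "'a::real_normed_vector set \<Rightarrow> bool" where
  "normal_cone C \<longleftrightarrow> proper_cone C \<and>
     (\<exists>M. \<forall>x y. cone_le C 0 x \<and> cone_le C x y \<longrightarrow> norm x \<le> M * norm y)"

definition reproducing_cone :: "'a::real_normed_vector set \<Rightarrow> bool" where
  "reproducing_cone C \<longleftrightarrow> UNIV = {u - v | u v. u \<in> C \<and> v \<in> C}"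

definition pos_homogeneous :: "('a::real_normed_vector \<Rightarrow> 'a) \<Rightarrow> bool" where
  "pos_homogeneous h \<longleftrightarrow> (\<forall>t>0. \<forall>x. h (t *\<^sub>R x) = t *\<^sub>R h x)"

definition order_preserving :: "'a::real_normed_vector set \<Rightarrow> ('a \<Rightarrow> 'a) \<Rightarrow> bool" where
  "order_preserving C h \<longleftrightarrow> (\<forall>x y. cone_le C x y \<longrightarrow> cone_le C (h x) (h y))"

text \<open>As for \<^const>\<open>onorm\<close>, the point \<open>x = 0\<close> is not excluded: it contributes
  \<open>norm (h 0) / 0 = 0\<close>, which does not change the supremum over the nonzero points and gives the
  value \<open>0\<close> if \<open>K\<close> is the trivial cone. The supremum is a real one, hence meaningful only for \<open>h\<close>
  bounded on \<open>K\<close>; see \<open>cone_opnorm_bdd\<close> below.\<close>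

definition cone_opnorm :: "'a::real_normed_vector set \<Rightarrow> ('a \<Rightarrow> 'a) \<Rightarrow> real" where
  "cone_opnorm K h = (SUP x\<in>K. norm (h x) / norm x)"

definition bonsall_radius :: "'a::real_normed_vector set \<Rightarrow> ('a \<Rightarrow> 'a) \<Rightarrow> real" where
  "bonsall_radius K h = lim (\<lambda>k. root k (cone_opnorm K (h ^^ k)))"

definition cone_spectral_radius :: "'a::real_normed_vector set \<Rightarrow> ('a \<Rightarrow> 'a) \<Rightarrow> ereal" where
  "cone_spectral_radius K h = (SUP x\<in>K. limsup (\<lambda>k. ereal (root k (norm ((h ^^ k) x)))))"

text \<open>For a continuous positively homogeneous self-map of a cone the supremum in
  \<^const>\<open>cone_opnorm\<close> is finite, the limit in \<^const>\<open>bonsall_radius\<close> exists, and it equals the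
  infimum of the sequence.\<close>

lemma cone_opnorm_bdd:
  fixes h :: "'a::real_normed_vector \<Rightarrow> 'a"
  assumes K: "cone K" "0 \<in> K" and cont: "continuous_on K h" and hom: "pos_homogeneous h"
  shows "bdd_above ((\<lambda>x. norm (h x) / norm x) ` K)"
proof -
  have "h ((2::real) *\<^sub>R 0) = (2::real) *\<^sub>R h 0"
    using hom unfolding pos_homogeneous_def by (metis zero_less_numeral)
  hence h0: "h 0 = 0" by (simp add: scaleR_2)
  obtain d where d: "d > 0" "\<And>y. y \<in> K \<Longrightarrow> norm y < d \<Longrightarrow> norm (h y) < 1"
    using cont K(2) h0 unfolding continuous_on_iff
    by (metis dist_0_norm dist_commute zero_less_one)
  have "norm (h x) / norm x \<le> 2 / d" if x: "x \<in> K" for x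
  proof (cases "x = 0")
    case False
    define t where "t = d / 2 / norm x"
    have t: "t > 0" using d False by (simp add: t_def)
    have "t *\<^sub>R x \<in> K" using K(1) x t unfolding cone_def by simp
    moreover have "norm (t *\<^sub>R x) < d" using False d by (simp add: t_def)
    ultimately have "norm (h (t *\<^sub>R x)) < 1" by (rule d(2))
    moreover have "h (t *\<^sub>R x) = t *\<^sub>R h x" using hom t unfolding pos_homogeneous_def by blast
    ultimately have "t * norm (h x) < 1" using t by simp
    thus ?thesis using d False by (simp add: t_def field_simps)
  qed (use d in simp)
  thus ?thesis by (auto intro!: bdd_aboveI)
qed

lemma submult_root_tendsto_INF:
  fixes a :: "nat \<Rightarrow> real"
  assumes nn: "\<And>n. a n \<ge> 0" and sub: "\<And>m n. a (m + n) \<le> a m * a n"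
  shows "(\<lambda>n. root n (a n)) \<longlonglongrightarrow> (INF n\<in>{1..}. root n (a n))"
proof -
  define L where "L = (INF n\<in>{1..}. root n (a n))"
  have bdd: "bdd_below ((\<lambda>n. root n (a n)) ` {1..})"
    using nn by (intro bdd_belowI[of _ 0]) auto
  have low: "L \<le> root n (a n)" if "n \<ge> 1" for n
    unfolding L_def using that bdd by (intro cINF_lower) auto
  have L0: "L \<ge> 0" unfolding L_def using nn by (intro cINF_greatest) auto
  have "(\<lambda>n. root n (a n)) \<longlonglongrightarrow> L"
  proof (rule order_tendstoI)
    fix c assume "c < L"
    thus "\<forall>\<^sub>F n in sequentially. c < root n (a n)"
      using low by (intro eventually_sequentiallyI[of 1]) (meson less_le_trans)
  next
    fix c assume c: "L < c"
    then obtain b where b: "L < b" "b < c" using dense by blast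
    hence b0: "b > 0" using L0 by simp
    obtain m where m: "m \<ge> 1" "root m (a m) < b"
      using b(1) bdd unfolding L_def by (subst (asm) cINF_less_iff) auto
    have amb: "a m \<le> b ^ m"
      using m nn[of m] b0 by (metis less_eq_real_def power_mono real_root_ge_zero
          real_root_pow_pos2 less_le_trans zero_less_one One_nat_def Suc_le_eq)
    define D where "D = 1 + (\<Sum>r<m. a r / b ^ r)"
    have D: "D > 0" unfolding D_def using nn b0 by (intro add_pos_nonneg sum_nonneg) auto
    have aD: "a r \<le> b ^ r * D" if "r < m" for r
    proof -
      have "a r / b ^ r \<le> (\<Sum>r<m. a r / b ^ r)"
        using that nn b0 by (intro member_le_sum) auto
      hence "a r / b ^ r \<le> D" by (simp add: D_def)
      thus ?thesis using b0 by (simp add: field_simps)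
    qed
    have "a (q * m + r) \<le> b ^ (q * m + r) * D" if "r < m" for q r
    proof (induction q)
      case (Suc q)
      have "a (Suc q * m + r) \<le> a m * a (q * m + r)"
        using sub[of m "q * m + r"] by (simp add: add.assoc)
      also have "\<dots> \<le> b ^ m * (b ^ (q * m + r) * D)"
        using amb Suc nn b0 by (intro mult_mono) auto
      finally show ?case by (simp add: power_add algebra_simps)
    qed (use aD that in simp)
    from this[of "n mod m" "n div m" for n] have an: "a n \<le> b ^ n * D" for n
      using m(1) by simp
    have "(\<lambda>n. b * root n D) \<longlonglongrightarrow> b * 1"
      by (intro tendsto_mult tendsto_const LIMSEQ_root_const D)
    hence "\<forall>\<^sub>F n in sequentially. b * root n D < c" using b by (intro order_tendstoD) auto
    thus "\<forall>\<^sub>F n in sequentially. root n (a n) < c"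
      using eventually_ge_at_top[of 1]
    proof eventually_elim
      case (elim n)
      have "root n (a n) \<le> root n (b ^ n * D)" using an elim by simp
      also have "\<dots> = b * root n D" using elim b0 by (simp add: real_root_mult real_root_power_cancel)
      finally show ?case using elim by simp
    qed
  qed
  thus ?thesis by (simp add: L_def)
qed

lemma bonsall_radius_INF:
  fixes h :: "'a::real_normed_vector \<Rightarrow> 'a"
  assumes K: "cone K" "0 \<in> K" and cont: "continuous_on K h" and hom: "pos_homogeneous h"
    and self: "h ` K \<subseteq> K"
  shows "(\<lambda>k. root k (cone_opnorm K (h ^^ k))) \<longlonglongrightarrow> bonsall_radius K h"
    and "bonsall_radius K h = (INF k\<in>{1..}. root k (cone_opnorm K (h ^^ k)))"
proof -
  have it: "continuous_on K (h ^^ k) \<and> pos_homogeneous (h ^^ k) \<and> (h ^^ k) ` K \<subseteq> K" for k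
  proof (induction k)
    case (Suc k)
    have "continuous_on K (h \<circ> (h ^^ k))"
      using Suc cont by (intro continuous_on_compose) (auto intro: continuous_on_subset)
    moreover have "(h \<circ> (h ^^ k)) ` K \<subseteq> K"
      using Suc self by (simp add: image_subset_iff)
    moreover have "pos_homogeneous (h \<circ> (h ^^ k))"
      using Suc hom by (simp add: pos_homogeneous_def)
    ultimately show ?case by (simp add: comp_def)
  qed (auto simp: pos_homogeneous_def)
  have bdd: "bdd_above ((\<lambda>x. norm ((h ^^ k) x) / norm x) ` K)" for k
    using it[of k] by (intro cone_opnorm_bdd[OF K]) simp_all
  have le: "norm ((h ^^ k) x) / norm x \<le> cone_opnorm K (h ^^ k)" if "x \<in> K" for k x
    unfolding cone_opnorm_def using that bdd by (intro cSUP_upper)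
  have nn: "cone_opnorm K (h ^^ k) \<ge> 0" for k using le[OF K(2), of k] by simp
  have "cone_opnorm K (h ^^ (m + n)) \<le> cone_opnorm K (h ^^ m) * cone_opnorm K (h ^^ n)" for m n
    unfolding cone_opnorm_def[of K "h ^^ (m + n)"]
  proof (rule cSUP_least)
    fix x assume x: "x \<in> K"
    let ?y = "(h ^^ n) x"
    have y: "?y \<in> K" using it x by blast
    show "norm ((h ^^ (m + n)) x) / norm x \<le> cone_opnorm K (h ^^ m) * cone_opnorm K (h ^^ n)"
    proof (cases "?y = 0")
      case False
      have "norm ((h ^^ (m + n)) x) / norm x = norm ((h ^^ m) ?y) / norm ?y * (norm ?y / norm x)"
        using False by (simp add: funpow_add)
      also have "\<dots> \<le> cone_opnorm K (h ^^ m) * cone_opnorm K (h ^^ n)"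
        using le[OF x] le[OF y] nn by (intro mult_mono) auto
      finally show ?thesis .
    next
      case True
      have "pos_homogeneous (h ^^ m)" using it by blast
      hence "(h ^^ m) ((2::real) *\<^sub>R 0) = (2::real) *\<^sub>R (h ^^ m) 0"
        unfolding pos_homogeneous_def by (metis zero_less_numeral)
      hence "(h ^^ m) 0 = 0" by (simp add: scaleR_2)
      thus ?thesis using True nn by (simp add: funpow_add)
    qed
  qed (use K in auto)
  from submult_root_tendsto_INF[OF nn this]
  have *: "(\<lambda>k. root k (cone_opnorm K (h ^^ k))) \<longlonglongrightarrow>
      (INF k\<in>{1..}. root k (cone_opnorm K (h ^^ k)))" .
  show eq: "bonsall_radius K h = (INF k\<in>{1..}. root k (cone_opnorm K (h ^^ k)))"
    unfolding bonsall_radius_def using * by (rule limI)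
  show "(\<lambda>k. root k (cone_opnorm K (h ^^ k))) \<longlonglongrightarrow> bonsall_radius K h"
    using * eq by simp
qed

end

theory Submission
  imports Defs
begin

text \<open>Every cone spectral radius is at most the corresponding Bonsall radius, so the chain of
  equalities closes once two inequalities are known. Both come from Baire's theorem.

  \<^item> \<open>bonsall_radius C h \<le> cone_spectral_radius C h\<close>: for \<open>s\<close> above the right-hand side the
  complete space \<open>C\<close> is the union of the closed sets
  \<open>{x. \<forall>k. norm ((h ^^ k) x) \<le> n * s ^ k}\<close>. One of them contains all \<open>x\<^sub>0 + y\<close> with \<open>y \<in> C\<close> small,
  and as \<open>0 \<le> (h ^^ k) y \<le> (h ^^ k) (x\<^sub>0 + y)\<close>, normality bounds \<open>(h ^^ k) y\<close> uniformly in \<open>y\<close>.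
  The cone \<open>- C\<close> satisfies the same hypotheses.

  \<^item> \<open>bonsall_radius UNIV h\<close> is at most the maximum of the radii on \<open>C\<close> and \<open>- C\<close>: since
  \<open>- v \<le> u - v \<le> u\<close>, normality controls \<open>(h ^^ k) (u - v)\<close> by \<open>(h ^^ k) u\<close> and
  \<open>(h ^^ k) (- v)\<close>. Small vectors are limits of such differences with \<open>u\<close> and \<open>v\<close> bounded,
  which is enough because \<open>h ^^ k\<close> is continuous.\<close>

section \<open>Baire's theorem on a closed subset\<close>

text \<open>The category theorem is applied to \<open>S\<close> as a complete metric space in its
  own right. The ball is relative to \<open>S\<close> because a closed cone may have empty interior
  in the whole space.\<close>

lemma closed_cover_contains_ball:
  fixes S :: "'a::complete_space set" and A :: "nat \<Rightarrow> 'a set"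
  assumes S: "closed S" "S \<noteq> {}" and A: "\<And>n. closed (A n)" and cover: "S \<subseteq> (\<Union>n. A n)"
  obtains n x d where "x \<in> S" "d > 0" "S \<inter> ball x d \<subseteq> A n"
proof -
  let ?X = "top_of_set S" and ?G = "range (\<lambda>n. S \<inter> A n)"
  have "completely_metrizable_space ?X"
    using S(1) by (intro completely_metrizable_space_closedin completely_metrizable_space_euclidean) auto
  moreover have "closedin ?X T" if "T \<in> ?G" for T
    using that A by (auto intro: closedin_closed_Int)
  moreover have "\<Union>?G = S" using cover by auto
  then have "?X interior_of \<Union>?G \<noteq> {}"
    using S(2) by (metis interior_of_topspace topspace_euclidean_subtopology)
  ultimately obtain n where "?X interior_of (S \<inter> A n) \<noteq> {}"
    using Baire_category_alt[of ?X ?G] by auto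
  then obtain x T where T: "openin ?X T" "x \<in> T" "T \<subseteq> S \<inter> A n"
    unfolding interior_of_def by auto
  then obtain d where "d > 0" "ball x d \<inter> S \<subseteq> T"
    using openin_contains_ball by metis
  then show ?thesis using that[of x d n] T by blast
qed

section \<open>Homogeneous and order-preserving maps and their iterates\<close>

text \<open>Homogeneity is stated for \<open>t > 0\<close> only, so \<open>t = 0\<close> cannot be
  inserted; \<open>t = 2\<close> gives \<open>h 0 = 2 h 0\<close> instead.\<close>

lemma pos_homogeneous_0:
  assumes "pos_homogeneous h" shows "h 0 = 0"
proof -
  have "h ((2::real) *\<^sub>R 0) = (2::real) *\<^sub>R h 0"
    using assms unfolding pos_homogeneous_def by (metis zero_less_numeral)
  then show ?thesis by (simp add: scaleR_2)
qed

lemma pos_homogeneous_funpow: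
  assumes "pos_homogeneous h" shows "pos_homogeneous (h ^^ k)"
  using assms by (induction k) (auto simp: pos_homogeneous_def)

lemma order_preserving_funpow:
  assumes "order_preserving C h" shows "order_preserving C (h ^^ k)"
  using assms by (induction k) (auto simp: order_preserving_def)

lemma continuous_on_funpow_UNIV:
  fixes h :: "'a::topological_space \<Rightarrow> 'a"
  assumes "continuous_on UNIV h" shows "continuous_on UNIV (h ^^ k)"
proof (induction k)
  case (Suc k)
  then show ?case
    using continuous_on_compose[OF Suc continuous_on_subset[OF assms subset_UNIV]]
    by (simp add: comp_def)
qed simp

lemma order_preserving_cone_image:
  assumes "pos_homogeneous h" "order_preserving C h"
  shows "h ` C \<subseteq> C"
proof (rule image_subsetI)
  fix x assume "x \<in> C"
  then have "cone_le C 0 x" by (simp add: cone_le_def)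
  then have "cone_le C (h 0) (h x)" using assms(2) by (simp add: order_preserving_def)
  then show "h x \<in> C" by (simp add: cone_le_def pos_homogeneous_0[OF assms(1)])
qed

section \<open>Normal cones and passage to the negative cone\<close>

lemma proper_coneD:
  assumes "proper_cone C"
  shows "cone C" "closed C" "0 \<in> C" "\<And>x y. x \<in> C \<Longrightarrow> y \<in> C \<Longrightarrow> x + y \<in> C"
  using assms unfolding proper_cone_def using convex_cone by blast+

lemma normal_coneD:
  assumes "normal_cone C"
  obtains M where "proper_cone C" "M \<ge> 0"
    "\<And>x y. x \<in> C \<Longrightarrow> y - x \<in> C \<Longrightarrow> norm x \<le> M * norm y"
proof -
  obtain M where p: "proper_cone C"
    and M: "\<And>x y. x \<in> C \<Longrightarrow> y - x \<in> C \<Longrightarrow> norm x \<le> M * norm y"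
    using assms unfolding normal_cone_def cone_le_def by auto
  \<comment> \<open>The absolute value keeps the bound valid and makes the constant nonnegative, so
    that inequalities may later be multiplied by it.\<close>
  have "norm x \<le> \<bar>M\<bar> * norm y" if "x \<in> C" "y - x \<in> C" for x y
    using M[OF that] by (meson abs_ge_self mult_right_mono norm_ge_zero order_trans)
  with p show ?thesis using that abs_ge_zero by blast
qed

lemma in_image_uminus_iff:
  fixes x :: "'a::group_add"
  shows "x \<in> uminus ` A \<longleftrightarrow> - x \<in> A"
  using image_eqI[of x uminus "- x" A] by auto

lemma normal_cone_uminus:
  assumes "normal_cone C" shows "normal_cone (uminus ` C)"
proof -
  obtain M where p: "proper_cone C"
    and M: "\<And>x y. x \<in> C \<Longrightarrow> y - x \<in> C \<Longrightarrow> norm x \<le> M * norm y"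
    using normal_coneD[OF assms] by metis
  have "closed (uminus ` C)" "convex (uminus ` C)" "uminus ` C \<inter> uminus ` uminus ` C = {0}"
    using p unfolding proper_cone_def
    by (auto simp: closed_negations convex_negations image_image Int_commute)
  moreover have "cone (uminus ` C)"
    using proper_coneD(1)[OF p] by (simp add: cone_def in_image_uminus_iff flip: scaleR_minus_right)
  moreover have "norm x \<le> M * norm y" if "x \<in> uminus ` C" "y - x \<in> uminus ` C" for x y
    using M[of "- x" "- y"] that by (simp add: in_image_uminus_iff)
  ultimately show ?thesis
    unfolding normal_cone_def proper_cone_def cone_le_def by (auto intro!: exI[of _ M])
qed

text \<open>Negating the cone reverses the order, and reversing both sides preserves monotonicity.
  Together with \<open>normal_cone_uminus\<close> this lets results for \<open>C\<close> be applied
  to \<open>- C\<close>.\<close>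

lemma order_preserving_uminus:
  assumes "order_preserving C h" shows "order_preserving (uminus ` C) h"
proof -
  have "cone_le (uminus ` C) x y \<longleftrightarrow> cone_le C y x" for x y
    using in_image_uminus_iff[of "y - x" C] by (simp add: cone_le_def)
  then show ?thesis using assms by (simp add: order_preserving_def)
qed

section \<open>Estimates for the operator norm on a cone\<close>

lemma norm_le_cone_opnorm:
  assumes "cone K" "0 \<in> K" "continuous_on K h" "pos_homogeneous h" "x \<in> K"
  shows "norm (h x) \<le> cone_opnorm K h * norm x"
proof (cases "x = 0")
  case False
  have "norm (h x) / norm x \<le> cone_opnorm K h"
    unfolding cone_opnorm_def using cone_opnorm_bdd[OF assms(1-4)] assms(5) by (intro cSUP_upper)
  then show ?thesis using False by (simp add: field_simps)
qed (use pos_homogeneous_0[OF assms(4)] in simp)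

lemma cone_opnorm_nonneg:
  assumes "cone K" "0 \<in> K" "continuous_on K h" "pos_homogeneous h"
  shows "cone_opnorm K h \<ge> 0"
  unfolding cone_opnorm_def
  \<comment> \<open>The supremum dominates the value at the point 0, which is a division by zero and
    hence 0.\<close>
  using cSUP_upper[OF assms(2) cone_opnorm_bdd[OF assms]] by simp

text \<open>By homogeneity a nonzero \<open>x\<close> may be rescaled to norm \<open>d / 2\<close>,
  strictly inside the ball; this is the source of the factor \<open>2 / d\<close>.\<close>

lemma cone_opnorm_le_of_ball:
  assumes K: "cone K" "0 \<in> K" and hom: "pos_homogeneous h" and d: "d > 0"
    and B: "\<And>x. x \<in> K \<Longrightarrow> norm x < d \<Longrightarrow> norm (h x) \<le> B"
  shows "cone_opnorm K h \<le> 2 / d * B"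
  unfolding cone_opnorm_def
proof (rule cSUP_least)
  fix x assume x: "x \<in> K"
  have B0: "B \<ge> 0" using order_trans[OF norm_ge_zero B[OF K(2)]] d by simp
  show "norm (h x) / norm x \<le> 2 / d * B"
  proof (cases "x = 0")
    case False
    define t where "t = d / 2 / norm x"
    have t: "t > 0" using d False by (simp add: t_def)
    have "norm (h (t *\<^sub>R x)) \<le> B"
      using K(1) x t False d by (intro B) (simp_all add: cone_def, simp add: t_def)
    moreover have "h (t *\<^sub>R x) = t *\<^sub>R h x" using hom t unfolding pos_homogeneous_def by blast
    ultimately have "t * norm (h x) \<le> B" using t by simp
    then show ?thesis using d False by (simp add: t_def field_simps)
  qed (use d B0 in simp)
qed (use K in auto)

lemma cone_opnorm_mono:
  assumes "K \<subseteq> L" "cone K" "0 \<in> K" "cone L" "continuous_on L h" "pos_homogeneous h"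
  shows "cone_opnorm K h \<le> cone_opnorm L h"
  unfolding cone_opnorm_def using assms
  by (intro cSUP_subset_mono cone_opnorm_bdd) auto

text \<open>The finitely many exceptional indices are absorbed into the constant. It is a natural
  number so that it can index a countable cover.\<close>

lemma eventually_le_power_bound:
  fixes a :: "nat \<Rightarrow> real" and s :: real
  assumes s: "s > 0" and a: "\<And>k. a k \<ge> 0" and ev: "\<forall>\<^sub>F k in sequentially. a k \<le> s ^ k"
  obtains n :: nat where "\<forall>k. a k \<le> n * s ^ k"
proof -
  obtain N where N: "\<And>k. k \<ge> N \<Longrightarrow> a k \<le> s ^ k"
    using ev unfolding eventually_sequentially by auto
  \<comment> \<open>The sum dominates each exceptional ratio, and the summand 1 handles all later
    indices.\<close>
  obtain n :: nat where n: "1 + (\<Sum>k<N. a k / s ^ k) \<le> n" using real_arch_simple by blast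
  have "a k / s ^ k \<le> n" for k
  proof (cases "k < N")
    case True
    then have "a k / s ^ k \<le> (\<Sum>k<N. a k / s ^ k)"
      using a s by (intro member_le_sum) auto
    then show ?thesis using n by simp
  next
    case False
    have "0 \<le> (\<Sum>k<N. a k / s ^ k)" using a s by (intro sum_nonneg) auto
    moreover have "a k / s ^ k \<le> 1" using N[of k] False s by simp
    ultimately show ?thesis using n by simp
  qed
  then show ?thesis using that[of n] s by (simp add: field_simps)
qed

section \<open>The two radii on an invariant cone\<close>

context
  fixes K :: "'a::real_normed_vector set" and h :: "'a \<Rightarrow> 'a"
  assumes K: "cone K" "0 \<in> K"
    and cont: "continuous_on UNIV h" and hom: "pos_homogeneous h" and self: "h ` K \<subseteq> K"
begin

private lemma cont_funpow: "continuous_on L (h ^^ k)"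
  using continuous_on_funpow_UNIV[OF cont] continuous_on_subset by blast

private lemmas tendsto_bonsall =
  bonsall_radius_INF(1)[OF K continuous_on_subset[OF cont subset_UNIV] hom self]

text \<open>The constant \<open>D\<close> disappears in the limit because its k-th roots tend to
  1.\<close>

lemma bonsall_radius_le:
  assumes D: "D > 0" and s: "s \<ge> 0" and le: "\<And>k. cone_opnorm K (h ^^ k) \<le> D * s ^ k"
  shows "bonsall_radius K h \<le> s"
proof (rule LIMSEQ_le[OF tendsto_bonsall])
  show "(\<lambda>k. root k D * s) \<longlonglongrightarrow> s"
    using tendsto_mult[OF LIMSEQ_root_const[OF D] tendsto_const[of s]] by simp
  have "root k (cone_opnorm K (h ^^ k)) \<le> root k D * s" if "k \<ge> 1" for k
  proof -
    have "root k (cone_opnorm K (h ^^ k)) \<le> root k (D * s ^ k)" using le that by simp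
    also have "\<dots> = root k D * s" using that s by (simp add: real_root_mult real_root_power_cancel)
    finally show ?thesis .
  qed
  then show "\<exists>N. \<forall>k\<ge>N. root k (cone_opnorm K (h ^^ k)) \<le> root k D * s" by blast
qed

text \<open>An orbit is bounded by the operator norms of the iterates times a factor depending only
  on \<open>x\<close>, and the k-th roots of that factor tend to 1.\<close>

lemma cone_spectral_radius_le_bonsall:
  "cone_spectral_radius K h \<le> ereal (bonsall_radius K h)"
  unfolding cone_spectral_radius_def
proof (rule SUP_least)
  fix x assume x: "x \<in> K"
  \<comment> \<open>The summand 1 covers \<open>x = 0\<close>, where the root of the norm would not tend to 1.\<close>
  let ?D = "norm x + 1"
  let ?g = "\<lambda>k. root k ?D * root k (cone_opnorm K (h ^^ k))"
  have D: "?D > 0" by (simp add: add_nonneg_pos)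
  have "(\<lambda>k. ereal (?g k)) \<longlonglongrightarrow> ereal (bonsall_radius K h)"
    using tendsto_mult[OF LIMSEQ_root_const[OF D] tendsto_bonsall] by simp
  then have lim: "limsup (\<lambda>k. ereal (?g k)) = ereal (bonsall_radius K h)"
    by (intro lim_imp_Limsup) auto
  have "root k (norm ((h ^^ k) x)) \<le> ?g k" if "k \<ge> 1" for k
  proof -
    note * = K cont_funpow pos_homogeneous_funpow[OF hom]
    have "norm ((h ^^ k) x) \<le> cone_opnorm K (h ^^ k) * norm x"
      by (rule norm_le_cone_opnorm[OF * x])
    also have "\<dots> \<le> ?D * cone_opnorm K (h ^^ k)"
      using cone_opnorm_nonneg[OF *, of k] by (simp add: algebra_simps)
    finally have "root k (norm ((h ^^ k) x)) \<le> root k (?D * cone_opnorm K (h ^^ k))"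
      using that by simp
    then show ?thesis by (simp add: real_root_mult)
  qed
  then have "limsup (\<lambda>k. ereal (root k (norm ((h ^^ k) x)))) \<le> limsup (\<lambda>k. ereal (?g k))"
    by (intro Limsup_mono eventually_sequentiallyI[of 1]) simp
  with lim show "limsup (\<lambda>k. ereal (root k (norm ((h ^^ k) x)))) \<le> ereal (bonsall_radius K h)"
    by simp
qed

end

section \<open>The reverse inequality on a normal cone\<close>

lemma bonsall_le_cone_spectral_radius:
  fixes C :: "'a::banach set"
  assumes "normal_cone C" and cont: "continuous_on UNIV h"
    and hom: "pos_homogeneous h" and ord: "order_preserving C h"
  shows "ereal (bonsall_radius C h) \<le> cone_spectral_radius C h"
proof (rule ccontr)
  obtain M where p: "proper_cone C" and M0: "M \<ge> 0"
    and M: "\<And>x y. x \<in> C \<Longrightarrow> y - x \<in> C \<Longrightarrow> norm x \<le> M * norm y"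
    using normal_coneD[OF assms(1)] by metis
  note C = proper_coneD[OF p]
  let ?l = "\<lambda>x. limsup (\<lambda>k. ereal (root k (norm ((h ^^ k) x))))"
  assume "\<not> ereal (bonsall_radius C h) \<le> cone_spectral_radius C h"
  then obtain s where s: "cone_spectral_radius C h < ereal s" "s < bonsall_radius C h"
    using ereal_dense2[of "cone_spectral_radius C h" "ereal (bonsall_radius C h)"] by (auto simp: not_le)
  have l: "?l x < ereal s" if "x \<in> C" for x
    using s(1) SUP_upper[OF that, of ?l] unfolding cone_spectral_radius_def by simp
  \<comment> \<open>The point 0 of \<open>C\<close> has nonnegative growth rate, which forces
    \<open>s\<close> to be positive.\<close>
  have "0 \<le> ?l 0" by (intro le_Limsup always_eventually) (auto intro: real_root_ge_zero)
  then have s0: "s > 0" using l[OF C(3)] by (metis ereal_less(2) order_le_less_trans)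
  define A where "A n = {x. \<forall>k. norm ((h ^^ k) x) \<le> real n * s ^ k}" for n
  have "closed (A n)" for n
    unfolding A_def
    by (intro closed_Collect_all closed_Collect_le continuous_on_norm continuous_on_const
        continuous_on_funpow_UNIV cont)
  moreover have "C \<subseteq> (\<Union>n. A n)"
  proof
    fix x assume x: "x \<in> C"
    have "\<forall>\<^sub>F k in sequentially. norm ((h ^^ k) x) \<le> s ^ k"
      \<comment> \<open>The index 0 must be excluded: \<open>root 0\<close> is constantly 0, so its
        value says nothing about the norm.\<close>
      using Limsup_lessD[OF l[OF x]] eventually_ge_at_top[of 1]
    proof eventually_elim
      case (elim k)
      then have "root k (norm ((h ^^ k) x)) ^ k \<le> s ^ k" by (intro power_mono) auto
      then show ?case using elim by simp
    qed
    then obtain n :: nat where "\<forall>k. norm ((h ^^ k) x) \<le> n * s ^ k"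
      by (rule eventually_le_power_bound[OF s0 norm_ge_zero])
    then show "x \<in> (\<Union>n. A n)" by (auto simp: A_def)
  qed
  moreover have "C \<noteq> {}" using C(3) by blast
  ultimately obtain n x d where nxd: "x \<in> C" "d > 0" "C \<inter> ball x d \<subseteq> A n"
    using closed_cover_contains_ball[OF C(2), of A] by metis
  have "cone_opnorm C (h ^^ k) \<le> 2 / d * (M * n * s ^ k)" for k
  proof (rule cone_opnorm_le_of_ball[OF C(1,3) pos_homogeneous_funpow[OF hom] nxd(2)])
    fix y assume y: "y \<in> C" "norm y < d"
    then have "x + y \<in> A n" using nxd C(4) by (auto simp: dist_norm)
    then have *: "norm ((h ^^ k) (x + y)) \<le> n * s ^ k" by (auto simp: A_def)
    note o = order_preserving_funpow[OF ord, of k]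
    have "(h ^^ k) (x + y) - (h ^^ k) y \<in> C"
      using o nxd(1) by (simp add: order_preserving_def cone_le_def)
    moreover have "(h ^^ k) y \<in> C"
      using order_preserving_cone_image[OF pos_homogeneous_funpow[OF hom] o] y by blast
    ultimately have "norm ((h ^^ k) y) \<le> M * norm ((h ^^ k) (x + y))" by (intro M)
    also have "\<dots> \<le> M * (n * s ^ k)" using * M0 by (intro mult_left_mono)
    finally show "norm ((h ^^ k) y) \<le> M * n * s ^ k" by (simp add: mult.assoc)
  qed
  \<comment> \<open>The added 1 makes the constant strictly positive even if \<open>M\<close> or
    \<open>n\<close> is 0, as \<open>bonsall_radius_le\<close> requires.\<close>
  moreover have "2 / d * (M * n * s ^ k) \<le> (2 / d * (M * n) + 1) * s ^ k" for k
    using s0 by (simp add: algebra_simps)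
  ultimately have "cone_opnorm C (h ^^ k) \<le> (2 / d * (M * n) + 1) * s ^ k" for k
    by (rule order_trans)
  moreover have "2 / d * (M * n) + 1 > 0"
    using nxd(2) M0 by (intro add_nonneg_pos mult_nonneg_nonneg) auto
  ultimately have "bonsall_radius C h \<le> s"
    using s0 order_preserving_cone_image[OF hom ord]
    by (intro bonsall_radius_le[OF C(1,3) cont hom]) auto
  with s(2) show False by simp
qed

section \<open>From the cones to the whole space\<close>

text \<open>The space is the union of the closures of the sets \<open>E n\<close>, so by Baire one
  closure contains a ball around some \<open>x\<close>. Subtracting approximations of
  \<open>x\<close> moves the ball to the origin.\<close>

lemma reproducing_ball_in_closure:
  fixes C :: "'a::banach set"
  assumes p: "proper_cone C" and "reproducing_cone C"
  obtains r d where "r > 0" "d > 0"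
    "ball 0 d \<subseteq> closure {u - v | u v. u \<in> C \<and> v \<in> C \<and> norm u \<le> r \<and> norm v \<le> r}"
proof -
  define E where "E r = {u - v | u v. u \<in> C \<and> v \<in> C \<and> norm u \<le> r \<and> norm v \<le> r}" for r :: real
  have "x \<in> (\<Union>n. closure (E (real n)))" for x
  proof -
    obtain u v where uv: "x = u - v" "u \<in> C" "v \<in> C"
      using assms(2) unfolding reproducing_cone_def by blast
    obtain n :: nat where "max (norm u) (norm v) \<le> n" using real_arch_simple by blast
    then have "x \<in> E n" using uv by (auto simp: E_def)
    then show ?thesis using closure_subset by blast
  qed
  then have "UNIV \<subseteq> (\<Union>n. closure (E (real n)))" by blast
  then obtain n x d where nxd: "d > 0" "UNIV \<inter> ball x d \<subseteq> closure (E (real n))"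
    using closed_cover_contains_ball[OF closed_UNIV UNIV_not_empty closed_closure] by metis
  \<comment> \<open>Regrouping a difference of two elements of \<open>E n\<close> doubles the bound;
    the extra 1 makes the radius positive when \<open>n = 0\<close>.\<close>
  have "y \<in> closure (E (2 * real n + 1))" if y: "y \<in> ball 0 d" for y
  proof -
    have "x + y \<in> closure (E n)" "x \<in> closure (E n)"
      using nxd y by (auto simp: subset_iff dist_norm)
    then obtain f g where f: "\<And>i. f i \<in> E n" "f \<longlonglongrightarrow> x + y" and g: "\<And>i. g i \<in> E n" "g \<longlonglongrightarrow> x"
      unfolding closure_sequential by metis
    have "f i - g i \<in> E (2 * real n + 1)" for i
    proof -
      obtain u v where u: "f i = u - v" "u \<in> C" "v \<in> C" "norm u \<le> n" "norm v \<le> n"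
        using f(1)[of i] by (auto simp: E_def)
      obtain u' v' where u': "g i = u' - v'" "u' \<in> C" "v' \<in> C" "norm u' \<le> n" "norm v' \<le> n"
        using g(1)[of i] by (auto simp: E_def)
      have "f i - g i = (u + v') - (v + u')" using u u' by simp
      moreover have "u + v' \<in> C" "v + u' \<in> C" using u u' proper_coneD(4)[OF p] by auto
      moreover have "norm (u + v') \<le> 2 * real n + 1" "norm (v + u') \<le> 2 * real n + 1"
        using u u' norm_triangle_ineq[of u v'] norm_triangle_ineq[of v u'] by auto
      ultimately show ?thesis unfolding E_def by blast
    qed
    moreover have "(\<lambda>i. f i - g i) \<longlonglongrightarrow> y" using tendsto_diff[OF f(2) g(2)] by simp
    ultimately show ?thesis unfolding closure_sequential by (intro exI[of _ "\<lambda>i. f i - g i"]) auto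
  qed
  then have "ball 0 d \<subseteq> closure (E (2 * real n + 1))" by blast
  then show ?thesis
    by (intro that[of "2 * real n + 1" d, folded E_def] nxd(1)) simp_all
qed

text \<open>The constant depends on the cone alone. It is fixed before \<open>h\<close>, so one
  \<open>D\<close> serves all iterates of a map.\<close>

lemma cone_opnorm_UNIV_le:
  fixes C :: "'a::banach set"
  assumes "normal_cone C" and "reproducing_cone C"
  obtains D where "D > 0"
    "\<And>h. \<lbrakk>continuous_on UNIV h; pos_homogeneous h; order_preserving C h\<rbrakk> \<Longrightarrow>
      cone_opnorm UNIV h \<le> D * max (cone_opnorm C h) (cone_opnorm (uminus ` C) h)"
proof -
  obtain M where p: "proper_cone C" and M0: "M \<ge> 0"
    and M: "\<And>x y. x \<in> C \<Longrightarrow> y - x \<in> C \<Longrightarrow> norm x \<le> M * norm y"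
    using normal_coneD[OF assms(1)] by metis
  have p': "proper_cone (uminus ` C)"
    using normal_cone_uminus[OF assms(1)] by (simp add: normal_cone_def)
  obtain r d where rd: "r > 0" "d > 0"
    "ball 0 d \<subseteq> closure {u - v | u v. u \<in> C \<and> v \<in> C \<and> norm u \<le> r \<and> norm v \<le> r}" (is "_ \<subseteq> closure ?E")
    using reproducing_ball_in_closure[OF p assms(2)] by blast
  \<comment> \<open>The factor \<open>2 / d\<close> comes from
    \<open>cone_opnorm_le_of_ball\<close>; the rest is the bound for \<open>h\<close> on
    \<open>?E\<close> in units of \<open>N\<close>.\<close>
  define D where "D = 2 / d * ((1 + M) * (2 * r))"
  have "cone_opnorm UNIV h \<le> D * max (cone_opnorm C h) (cone_opnorm (uminus ` C) h)"
    if cont: "continuous_on UNIV h" and hom: "pos_homogeneous h" and ord: "order_preserving C h" for h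
  proof -
    define N where "N = max (cone_opnorm C h) (cone_opnorm (uminus ` C) h)"
    have cK: "continuous_on K h" for K using cont continuous_on_subset by blast
    have NC: "norm (h u) \<le> N * norm u" if "u \<in> C \<union> uminus ` C" for u
    proof -
      have "norm (h u) \<le> cone_opnorm C h * norm u \<or> norm (h u) \<le> cone_opnorm (uminus ` C) h * norm u"
        using that norm_le_cone_opnorm[OF proper_coneD(1,3)[OF p] cK hom]
          norm_le_cone_opnorm[OF proper_coneD(1,3)[OF p'] cK hom] by blast
      moreover have "cone_opnorm C h * norm u \<le> N * norm u"
        "cone_opnorm (uminus ` C) h * norm u \<le> N * norm u"
        unfolding N_def by (auto intro!: mult_right_mono)
      ultimately show ?thesis by linarith
    qed
    have N0: "N \<ge> 0"
      using cone_opnorm_nonneg[OF proper_coneD(1,3)[OF p] cK hom] by (simp add: N_def)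
    have hE: "norm (h x) \<le> (1 + M) * (2 * r) * N" if "x \<in> ?E" for x
    proof -
      obtain u v where x: "x = u - v" and uv: "u \<in> C" "v \<in> C" "norm u \<le> r" "norm v \<le> r"
        using \<open>x \<in> ?E\<close> by blast
      have nu: "norm (h u) \<le> N * r"
        using NC[of u] uv N0 by (auto intro: order_trans mult_left_mono)
      have nv: "norm (h (- v)) \<le> N * r"
        using NC[of "- v"] uv N0 by (auto intro: order_trans mult_left_mono)
      \<comment> \<open>From \<open>- v\<close> \<le> \<open>x\<close> \<le> \<open>u\<close>,
        subtracting \<open>h (- v)\<close> makes both sides nonnegative in the order, where
        normality applies.\<close>
      have "h x - h (- v) \<in> C" "(h u - h (- v)) - (h x - h (- v)) \<in> C"
        using ord uv x by (auto simp: order_preserving_def cone_le_def)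
      then have "norm (h x - h (- v)) \<le> M * norm (h u - h (- v))" by (rule M)
      also have "\<dots> \<le> M * (N * r + N * r)"
        using nu nv norm_triangle_ineq4[of "h u" "h (- v)"] M0 by (intro mult_left_mono) auto
      finally have "norm (h x) \<le> N * r + M * (N * r + N * r)"
        using nv norm_triangle_sub[of "h x" "h (- v)"] by simp
      also have "\<dots> \<le> (1 + M) * (2 * r) * N" using N0 rd(1) by (simp add: algebra_simps)
      finally show ?thesis .
    qed
    have "norm (h x) \<le> (1 + M) * (2 * r) * N" if "norm x < d" for x
    proof -
      have "closed {x. norm (h x) \<le> (1 + M) * (2 * r) * N}"
        by (intro closed_Collect_le continuous_on_norm cont continuous_on_const)
      then have "closure ?E \<subseteq> {x. norm (h x) \<le> (1 + M) * (2 * r) * N}"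
        using hE by (intro closure_minimal) auto
      then show ?thesis using rd(3) that by (auto simp: subset_iff)
    qed
    then have "cone_opnorm UNIV h \<le> 2 / d * ((1 + M) * (2 * r) * N)"
      by (intro cone_opnorm_le_of_ball[OF _ _ hom rd(2)]) (auto simp: cone_def)
    then show ?thesis by (simp add: D_def N_def mult.assoc)
  qed
  moreover have "D > 0" using rd(1,2) M0 by (simp add: D_def)
  ultimately show ?thesis using that by blast
qed

text \<open>Operator norms of the iterates are compared before taking limits: one direction has a
  constant independent of \<open>k\<close>, the other is monotonicity of \<open>cone_opnorm\<close>
  in the cone.\<close>

lemma bonsall_radius_UNIV_eq:
  fixes C :: "'a::banach set"
  assumes nC: "normal_cone C" and rep: "reproducing_cone C"
    and cont: "continuous_on UNIV h" and hom: "pos_homogeneous h" and ord: "order_preserving C h"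
  shows "bonsall_radius UNIV h = max (bonsall_radius C h) (bonsall_radius (uminus ` C) h)"
proof (rule antisym)
  have cone: "cone C" "0 \<in> C" "cone (uminus ` C)" "0 \<in> uminus ` C"
    using nC normal_cone_uminus[OF nC] by (auto simp: normal_cone_def dest: proper_coneD)
  have U: "cone (UNIV :: 'a set)" by (simp add: cone_def)
  let ?a = "\<lambda>K k. cone_opnorm K (h ^^ k)"
  have cK: "continuous_on K h" for K using cont continuous_on_subset by blast
  have lim: "(\<lambda>k. root k (?a UNIV k)) \<longlonglongrightarrow> bonsall_radius UNIV h"
    "(\<lambda>k. root k (?a C k)) \<longlonglongrightarrow> bonsall_radius C h"
    "(\<lambda>k. root k (?a (uminus ` C) k)) \<longlonglongrightarrow> bonsall_radius (uminus ` C) h"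
    using U cone order_preserving_cone_image[OF hom ord]
      order_preserving_cone_image[OF hom order_preserving_uminus[OF ord]]
    by (intro bonsall_radius_INF(1) cK hom; simp)+
  obtain D where D: "D > 0" "\<And>k. ?a UNIV k \<le> D * max (?a C k) (?a (uminus ` C) k)"
    using cone_opnorm_UNIV_le[OF nC rep] continuous_on_funpow_UNIV[OF cont]
      pos_homogeneous_funpow[OF hom] order_preserving_funpow[OF ord] by metis
  show "bonsall_radius UNIV h \<le> max (bonsall_radius C h) (bonsall_radius (uminus ` C) h)"
  proof (rule LIMSEQ_le[OF lim(1)])
    show "(\<lambda>k. root k D * max (root k (?a C k)) (root k (?a (uminus ` C) k)))
        \<longlonglongrightarrow> max (bonsall_radius C h) (bonsall_radius (uminus ` C) h)"
      using tendsto_mult[OF LIMSEQ_root_const[OF D(1)] tendsto_max[OF lim(2,3)]] by simp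
    have "root k (?a UNIV k) \<le> root k D * max (root k (?a C k)) (root k (?a (uminus ` C) k))"
      if "k \<ge> 1" for k
    proof -
      have "root k (?a UNIV k) \<le> root k (D * max (?a C k) (?a (uminus ` C) k))"
        using D(2) that by simp
      then show ?thesis using that by (simp add: real_root_mult max_def split: if_splits)
    qed
    then show "\<exists>N. \<forall>k\<ge>N. root k (?a UNIV k)
        \<le> root k D * max (root k (?a C k)) (root k (?a (uminus ` C) k))" by blast
  qed
  have "root k (?a K k) \<le> root k (?a UNIV k)" if "k \<ge> 1" "cone K" "0 \<in> K" for k K
    using that U continuous_on_funpow_UNIV[OF cont] pos_homogeneous_funpow[OF hom]
    by (simp add: cone_opnorm_mono)
  then show "max (bonsall_radius C h) (bonsall_radius (uminus ` C) h) \<le> bonsall_radius UNIV h"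
    using cone by (intro max.boundedI LIMSEQ_le[OF lim(2) lim(1)] LIMSEQ_le[OF lim(3) lim(1)]) blast+
qed

section \<open>Equality of all the radii\<close>

lemma cone_spectral_radius_eq_bonsall:
  fixes C :: "'a::banach set"
  assumes nC: "normal_cone C" and cont: "continuous_on UNIV h"
    and hom: "pos_homogeneous h" and ord: "order_preserving C h"
  shows "cone_spectral_radius C h = ereal (bonsall_radius C h)"
  using nC proper_coneD(1,3)[of C]
  by (intro antisym bonsall_le_cone_spectral_radius[OF assms]
      cone_spectral_radius_le_bonsall[OF _ _ cont hom order_preserving_cone_image[OF hom ord]])
    (auto simp: normal_cone_def)

theorem lemma6p1:
  fixes C :: "'a::banach set" and h :: "'a \<Rightarrow> 'a"
  assumes "normal_cone C" and "reproducing_cone C"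
    and "continuous_on UNIV h" and "pos_homogeneous h" and "order_preserving C h"
  shows "h ` C \<subseteq> C \<and> h ` (uminus ` C) \<subseteq> uminus ` C \<and>
    ereal (bonsall_radius UNIV h)
      = ereal (max (bonsall_radius C h) (bonsall_radius (uminus ` C) h)) \<and>
    ereal (max (bonsall_radius C h) (bonsall_radius (uminus ` C) h))
      = max (cone_spectral_radius C h) (cone_spectral_radius (uminus ` C) h) \<and>
    max (cone_spectral_radius C h) (cone_spectral_radius (uminus ` C) h)
      = cone_spectral_radius UNIV h"
proof -
  note ord' = order_preserving_uminus[OF assms(5)]
  note bonsall = bonsall_radius_UNIV_eq[OF assms]
  have r: "cone_spectral_radius C h = ereal (bonsall_radius C h)"
    "cone_spectral_radius (uminus ` C) h = ereal (bonsall_radius (uminus ` C) h)"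
    using assms ord' normal_cone_uminus by (auto intro: cone_spectral_radius_eq_bonsall)
  have mono: "cone_spectral_radius K h \<le> cone_spectral_radius UNIV h" for K
    unfolding cone_spectral_radius_def by (intro SUP_subset_mono) auto
  \<comment> \<open>This closes the circle: the radius on \<open>UNIV\<close> lies above those on
    both cones by monotonicity, and below the Bonsall radius, which is already identified with their
    maximum.\<close>
  have "cone_spectral_radius UNIV h \<le> ereal (bonsall_radius UNIV h)"
    using assms by (intro cone_spectral_radius_le_bonsall) (auto simp: cone_def)
  then have "max (cone_spectral_radius C h) (cone_spectral_radius (uminus ` C) h)
      = cone_spectral_radius UNIV h"
    by (intro antisym max.boundedI mono) (simp add: bonsall r ereal_max)
  then show ?thesis
    using order_preserving_cone_image[OF assms(4)] assms(5) ord' bonsall r by (simp add: ereal_max)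
qed

end
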